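(* For every finite simple graph $G$, $Z_f(G) = Z^-(G)$.
   Context: All graphs are finite and simple. Skew zero forcing: initially some set of vertices of $G$ is colored blue and the rest white; the rule is: if $w$ is the only white neighbor of any vertex $u$ (blue or white), then $u$ may color $w$ blue. A skew zero forcing set is an initial blue set from which repeated application can make all vertices blue; $Z^-(G)$ is the minimum cardinality of a skew zero forcing set. For $r\in\mathbb{N}$, the $r$-blowup $G^{(r)}$ is obtained by replacing each vertex $u$ by an independent set $R_u$ of $r$ vertices and each edge $uw$ by all edges between $R_u$ and $R_w$. $r$-fold forcing game: an initial set $B\subseteq V(G^{(r)})$ is blue, the rest white; at each step, with $B_t$ the current blue set, if $u\in B_t$ and $|N(u)\setminus B_t|\le r$, then $u$ may color all of $N(u)\setminus B_t$ blue. $B$ is an $r$-fold forcing set if repeated application can make all of $G^{(r)}$ blue; $Z_{(r)}(G)$ is the minimum cardinality of an $r$-fold forcing set, and $Z_f(G)=\inf_{r\in\mathbb{N}} Z_{(r)}(G)/r$. *)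

theory Defs
  imports Complex_Main "Graph_Theory.Pair_Digraph"
begin

text \<open>
  Finite simple graphs are the \<^locale>\<open>pair_graph\<close>s of the library: finite, symmetric, loop-free
  sets of pairs, so an undirected edge is present as two opposite arcs. The null graph is allowed.
\<close>

definition neighbors :: "'a pair_pre_digraph \<Rightarrow> 'a \<Rightarrow> 'a set" where
  "neighbors G u = {w. (u, w) \<in> parcs G}"


section \<open>Skew zero forcing\<close>

text \<open>Vertex colorings are represented by the set \<open>B\<close> of blue vertices.\<close>

inductive skew_step :: "'a pair_pre_digraph \<Rightarrow> 'a set \<Rightarrow> 'a set \<Rightarrow> bool"
  for G :: "'a pair_pre_digraph" where
  "u \<in> pverts G \<Longrightarrow> neighbors G u - B = {w} \<Longrightarrow> skew_step G B (insert w B)"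

definition skew_forcing_set :: "'a pair_pre_digraph \<Rightarrow> 'a set \<Rightarrow> bool" where
  "skew_forcing_set G B \<longleftrightarrow> B \<subseteq> pverts G \<and> (skew_step G)\<^sup>*\<^sup>* B (pverts G)"

definition skew_forcing_number :: "'a pair_pre_digraph \<Rightarrow> nat" where
  "skew_forcing_number G = (LEAST k. \<exists>B. skew_forcing_set G B \<and> card B = k)"


section \<open>Fractional zero forcing\<close>

definition blowup :: "nat \<Rightarrow> 'a pair_pre_digraph \<Rightarrow> ('a \<times> nat) pair_pre_digraph" where
  "blowup r G =
    \<lparr> pverts = pverts G \<times> {..<r},
      parcs = {((u, i), (w, j)) | u i w j. (u, w) \<in> parcs G \<and> i < r \<and> j < r} \<rparr>"

inductive rfold_step :: "nat \<Rightarrow> 'a pair_pre_digraph \<Rightarrow> ('a \<times> nat) set \<Rightarrow> ('a \<times> nat) set \<Rightarrow> bool"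
  for r :: nat and G :: "'a pair_pre_digraph" where
  "u \<in> B \<Longrightarrow> card (neighbors (blowup r G) u - B) \<le> r
    \<Longrightarrow> rfold_step r G B (B \<union> neighbors (blowup r G) u)"

definition rfold_forcing_set :: "nat \<Rightarrow> 'a pair_pre_digraph \<Rightarrow> ('a \<times> nat) set \<Rightarrow> bool" where
  "rfold_forcing_set r G B \<longleftrightarrow>
    B \<subseteq> pverts (blowup r G) \<and> (rfold_step r G)\<^sup>*\<^sup>* B (pverts (blowup r G))"

definition rfold_forcing_number :: "nat \<Rightarrow> 'a pair_pre_digraph \<Rightarrow> nat" where
  "rfold_forcing_number r G = (LEAST k. \<exists>B. rfold_forcing_set r G B \<and> card B = k)"

text \<open>
  The natural numbers start at 1 here; including \<open>r = 0\<close> would put the junk value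
  \<open>0 / 0 = 0\<close> into the infimum.
\<close>

definition fractional_forcing_number :: "'a pair_pre_digraph \<Rightarrow> real" where
  "fractional_forcing_number G = (INF r\<in>{1..}. real (rfold_forcing_number r G) / real r)"


section \<open>Well-definedness\<close>

lemma pair_graph_blowup:
  assumes "pair_graph G"
  shows "pair_graph (blowup r G)"
proof -
  interpret pair_graph G by (fact assms)
  have fin: "finite (pverts G \<times> {..<r})"
    using pair_finite_verts by blast
  have sub: "parcs (blowup r G) \<subseteq> (pverts G \<times> {..<r}) \<times> (pverts G \<times> {..<r})"
    by (auto simp: blowup_def dest: in_arcsD1 in_arcsD2)
  have "(w, u) \<in> parcs G" if "(u, w) \<in> parcs G" for u w
    using that pair_sym_arcs by (auto simp: symmetric_def dest: symD)
  then have "symmetric (blowup r G)"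
    by (auto simp: symmetric_def blowup_def intro!: symI)
  moreover have "finite (parcs (blowup r G))"
    using sub fin by (meson finite_SigmaI finite_subset)
  ultimately show ?thesis
    using sub fin by unfold_locales (auto simp: blowup_def dest: no_loops' in_arcsD1 in_arcsD2)
qed

lemma skew_forcing_set_pverts: "skew_forcing_set G (pverts G)"
  by (simp add: skew_forcing_set_def)

lemma rfold_forcing_set_pverts: "rfold_forcing_set r G (pverts (blowup r G))"
  by (simp add: rfold_forcing_set_def)

lemma bdd_below_rfold_forcing_ratio:
  "bdd_below ((\<lambda>r. real (rfold_forcing_number r G) / real r) ` {1..})"
  by (rule bdd_belowI2[where m = 0]) simp

end

theory Submission
  imports Defs
begin

text \<open>
  Let \<open>n\<close> be the number of vertices. A skew forcing set \<open>S\<close> yields the \<open>r\<close>-fold forcing set that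
  contains all copies of the vertices of \<open>S\<close> and one copy of every other vertex: the additional
  copies allow every vertex to force, and they cost at most \<open>n\<close>, which is negligible against \<open>r\<close>.
  Hence \<open>Z\<^sub>(\<^sub>r\<^sub>) / r \<le> Z\<^sup>- + n / r\<close>.

  Conversely, read an \<open>r\<close>-fold forcing process backwards, starting from the skew forcing set of all
  vertices. Undoing a force by a copy of \<open>u\<close> removes at most \<open>r\<close> blue copies; if it makes some
  \<open>w \<in> N(u)\<close> not fully blue, then \<open>w\<close> can be dropped from the skew forcing set, because \<open>u\<close> forces
  it back at once. Hence \<open>r * Z\<^sup>- \<le> Z\<^sub>(\<^sub>r\<^sub>)\<close>.
\<close>

lemma pverts_blowup [simp]: "pverts (blowup r G) = pverts G \<times> {..<r}"
  by (simp add: blowup_def)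

lemma neighbors_blowup [simp]:
  "i < r \<Longrightarrow> neighbors (blowup r G) (u, i) = neighbors G u \<times> {..<r}"
  by (auto simp: neighbors_def blowup_def)

lemma skew_forcing_number_le: "skew_forcing_set G B \<Longrightarrow> skew_forcing_number G \<le> card B"
  unfolding skew_forcing_number_def by (rule Least_le) blast

lemma skew_forcing_number_attained:
  obtains B where "skew_forcing_set G B" "card B = skew_forcing_number G"
  unfolding skew_forcing_number_def
  using LeastI_ex[of "\<lambda>k. \<exists>B. skew_forcing_set G B \<and> card B = k"] skew_forcing_set_pverts by blast

lemma rfold_forcing_number_le: "rfold_forcing_set r G B \<Longrightarrow> rfold_forcing_number r G \<le> card B"
  unfolding rfold_forcing_number_def by (rule Least_le) blast

lemma rfold_forcing_number_attained:
  obtains B where "rfold_forcing_set r G B" "card B = rfold_forcing_number r G"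
  unfolding rfold_forcing_number_def
  using LeastI_ex[of "\<lambda>k. \<exists>B. rfold_forcing_set r G B \<and> card B = k"] rfold_forcing_set_pverts
  by blast

text \<open>Copy 0 of every vertex stays blue throughout, so a vertex \<open>u\<close> that
  skew-forces while white still has a blue copy. The white neighbors of that copy all lie over the
  single vertex \<open>w\<close>, hence number at most \<open>r\<close>.\<close>

lemma rfold_steps_of_skew_steps:
  assumes "(skew_step G)\<^sup>*\<^sup>* S T" and "r \<ge> 1"
  shows "(rfold_step r G)\<^sup>*\<^sup>* (S \<times> {..<r} \<union> pverts G \<times> {0}) (T \<times> {..<r} \<union> pverts G \<times> {0})"
  using assms(1)
proof (induction rule: rtranclp_induct)
  case base
  show ?case by simp
next
  case (step T T')
  let ?B = "T \<times> {..<r} \<union> pverts G \<times> {0}"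
  from step.hyps(2) obtain u w
    where u: "u \<in> pverts G" and w: "neighbors G u - T = {w}" and T': "T' = insert w T"
    by cases auto
  have nb: "neighbors (blowup r G) (u, 0) = neighbors G u \<times> {..<r}"
    using \<open>r \<ge> 1\<close> by simp
  have "neighbors G u \<times> {..<r} - ?B \<subseteq> {w} \<times> {..<r}"
    using w by auto
  then have "card (neighbors G u \<times> {..<r} - ?B) \<le> r"
    using card_mono[of "{w} \<times> {..<r}"] by (simp add: card_cartesian_product)
  moreover have "(u, 0) \<in> ?B"
    using u by simp
  ultimately have "rfold_step r G ?B (?B \<union> neighbors G u \<times> {..<r})"
    using rfold_step.intros[of "(u, 0)" ?B r G] nb by simp
  moreover have "?B \<union> neighbors G u \<times> {..<r} = T' \<times> {..<r} \<union> pverts G \<times> {0}"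
    using w T' by auto
  ultimately show ?case
    using step.IH by (metis rtranclp.rtrancl_into_rtrancl)
qed

lemma rfold_forcing_number_le_skew:
  assumes "finite (pverts G)" and "r \<ge> 1"
  shows "rfold_forcing_number r G \<le> skew_forcing_number G * r + card (pverts G)"
proof -
  obtain S where S: "skew_forcing_set G S" "card S = skew_forcing_number G"
    by (rule skew_forcing_number_attained)
  let ?B = "S \<times> {..<r} \<union> pverts G \<times> {0}"
  have "pverts G \<times> {..<r} \<union> pverts G \<times> {0} = pverts (blowup r G)"
    using \<open>r \<ge> 1\<close> by auto
  then have "rfold_forcing_set r G ?B"
    using rfold_steps_of_skew_steps[of G S "pverts G" r] S(1) \<open>r \<ge> 1\<close>
    by (auto simp: rfold_forcing_set_def skew_forcing_set_def)
  then have "rfold_forcing_number r G \<le> card ?B"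
    by (rule rfold_forcing_number_le)
  \<comment> \<open>Copies 0 of vertices in \<open>S\<close> are counted twice; the loss is harmless
    after division by \<open>r\<close>.\<close>
  also have "\<dots> \<le> card (S \<times> {..<r}) + card (pverts G \<times> {0::nat})"
    by (rule card_Un_le)
  finally show ?thesis
    using S(2) by (simp add: card_cartesian_product)
qed

lemma skew_steps_of_rfold_steps:
  assumes "finite (pverts G)" and "\<And>u. neighbors G u \<subseteq> pverts G"
    and "(rfold_step r G)\<^sup>*\<^sup>* B (pverts G \<times> {..<r})" and "B \<subseteq> pverts G \<times> {..<r}"
  shows "\<exists>S. {v \<in> pverts G. {v} \<times> {..<r} \<subseteq> B} \<subseteq> S \<and> skew_forcing_set G S \<and> card S * r \<le> card B"
  using assms(3,4)
proof (induction rule: converse_rtranclp_induct)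
  case base
  then show ?case
    by (intro exI[of _ "pverts G"]) (auto simp: skew_forcing_set_pverts card_cartesian_product)
next
  case (step B B')
  from step.hyps(1) obtain x where x: "x \<in> B" "card (neighbors (blowup r G) x - B) \<le> r"
    "B' = B \<union> neighbors (blowup r G) x"
    by cases auto
  obtain u i where ui: "x = (u, i)" by (cases x)
  with x(1) step.prems have u: "u \<in> pverts G" and i: "i < r" by auto
  let ?N = "neighbors G u"
  have card_new: "card (?N \<times> {..<r} - B) \<le> r" and B': "B' = B \<union> ?N \<times> {..<r}"
    using x(2,3) ui i by auto
  have B'_sub: "B' \<subseteq> pverts G \<times> {..<r}"
    using B' step.prems assms(2) by blast
  from step.IH[OF B'_sub] obtain S'
    where full: "{v \<in> pverts G. {v} \<times> {..<r} \<subseteq> B'} \<subseteq> S'"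
      and S': "S' \<subseteq> pverts G" "(skew_step G)\<^sup>*\<^sup>* S' (pverts G)" and card_S': "card S' * r \<le> card B'"
    by (auto simp: skew_forcing_set_def)
  have N_sub: "?N \<subseteq> S'"
    using full B' assms(2)[of u] by blast
  have finB: "finite B"
    using step.prems assms(1) finite_subset by blast
  show ?case
  proof (cases "?N \<times> {..<r} \<subseteq> B")
    case True
    then have "B' = B" using B' by blast
    then show ?thesis
      using full S' card_S' by (auto simp: skew_forcing_set_def)
  next
    case False
    then obtain w j where w: "w \<in> ?N" "j < r" "(w, j) \<notin> B" by auto
    let ?S = "S' - {w}"
    have "?N - ?S = {w}"
      using N_sub w(1) by blast
    \<comment> \<open>The color of \<open>u\<close> itself is irrelevant in the skew game.\<close>
    then have "skew_step G ?S (insert w ?S)"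
      using u by (rule skew_step.intros[rotated])
    moreover have "insert w ?S = S'"
      using N_sub w(1) by blast
    ultimately have "skew_forcing_set G ?S"
      using S' by (auto simp: skew_forcing_set_def intro: converse_rtranclp_into_rtranclp)
    \<comment> \<open>The white copy \<open>(w, j)\<close> shows that \<open>w\<close> is not fully
      blue in \<open>B\<close>.\<close>
    moreover have "{v \<in> pverts G. {v} \<times> {..<r} \<subseteq> B} \<subseteq> ?S"
      using full w B' by blast
    moreover have "card ?S * r \<le> card B"
    proof -
      \<comment> \<open>Dropping \<open>w\<close> lowers the left side by exactly \<open>r\<close>,
        which pays for the at most \<open>r\<close> copies that the force turned blue.\<close>
      have "card S' = Suc (card ?S)"
        using N_sub w(1) S'(1) assms(1) by (metis card_Suc_Diff1 finite_subset subsetD)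
      moreover have "card B' \<le> card B + r"
        using card_Un_le[of B "?N \<times> {..<r} - B"] card_new B' by (simp add: Un_Diff_cancel)
      ultimately show ?thesis
        using card_S' by simp
    qed
    ultimately show ?thesis by blast
  qed
qed

lemma skew_forcing_number_le_rfold:
  assumes "finite (pverts G)" and "\<And>u. neighbors G u \<subseteq> pverts G"
  shows "skew_forcing_number G * r \<le> rfold_forcing_number r G"
proof -
  obtain B where B: "rfold_forcing_set r G B" "card B = rfold_forcing_number r G"
    by (rule rfold_forcing_number_attained)
  then obtain S where "skew_forcing_set G S" "card S * r \<le> card B"
    using skew_steps_of_rfold_steps[OF assms, of r B] by (auto simp: rfold_forcing_set_def)
  then show ?thesis
    using skew_forcing_number_le B(2) by (metis le_trans mult_le_mono1)
qed

theorem theorem3p18: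
  fixes G :: "'a pair_pre_digraph"
  assumes "pair_graph G"
  shows "fractional_forcing_number G = real (skew_forcing_number G)"
proof (rule antisym)
  interpret pair_graph G by (fact assms)
  have fin: "finite (pverts G)" by (rule pair_finite_verts)
  let ?k = "skew_forcing_number G" and ?n = "card (pverts G)"
  have upper: "fractional_forcing_number G \<le> ?k + ?n / r" if "r \<ge> 1" for r :: nat
  proof -
    have "fractional_forcing_number G \<le> rfold_forcing_number r G / r"
      unfolding fractional_forcing_number_def
      using bdd_below_rfold_forcing_ratio that by (intro cINF_lower) auto
    also have "\<dots> \<le> real (?k * r + ?n) / r"
      using rfold_forcing_number_le_skew[OF fin that]
      by (intro divide_right_mono of_nat_mono) simp_all
    also have "\<dots> = ?k + ?n / r"
      using that by (simp add: add_divide_distrib)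
    finally show ?thesis .
  qed
  \<comment> \<open>The upper bound holds for all \<open>r\<close> \<ge> 1, so its error term
    vanishes in the limit.\<close>
  have "(\<lambda>r. ?k + ?n / real r) \<longlonglongrightarrow> real ?k + 0"
    by (intro tendsto_intros lim_const_over_n)
  then show "fractional_forcing_number G \<le> ?k"
    using upper by (intro LIMSEQ_le_const) auto
  have nbs: "neighbors G u \<subseteq> pverts G" for u
    by (auto simp: neighbors_def dest: in_arcsD2)
  \<comment> \<open>This direction has no error term: each ratio is bounded below
    separately.\<close>
  have "?k \<le> rfold_forcing_number r G / r" if "r \<ge> 1" for r
    using skew_forcing_number_le_rfold[OF fin nbs, of r] that
    by (simp add: pos_le_divide_eq flip: of_nat_mult)
  then show "?k \<le> fractional_forcing_number G"
    unfolding fractional_forcing_number_def by (intro cINF_greatest) auto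
qed

end
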